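(* For all integers $r\ge1$, $m$, $\tau$, and all integers $p$ with $p\le-1$ or $p\ge2$, the BPS invariants $b_{r,m}(U^\tau)$, $b_r^+(U^\tau)$, $b_r^-(U^\tau)$, $b_r^+(\mathcal{K}_p^\tau)$ and $b_r^-(\mathcal{K}_p^\tau)$, given by the explicit formulas listed in the context, are integers.
   Context: $\mu$ is the Möbius function. Binomial coefficients: for $n<0$ and $k\ge0$, $\binom nk=(-1)^k\binom{-n+k-1}{k}$. Here $U^\tau$ is the unknot with framing $\tau$ and $\mathcal{K}_p^\tau$ the twist knot $\mathcal{K}_p$ with framing $\tau$. Their BPS invariants and extremal BPS invariants are given by the following formulas. Framed unknot: $$b_{r,m}(U^\tau)=\frac1{r^2}\sum_{d\mid r,\ d\mid m}\mu(d)\,c_{\frac rd,\frac md}(U^\tau),$$ where $c_{r,m}(U^\tau)=(-1)^{r\tau+r+\frac{r+m}{2}}\binom{r}{\frac{r+m}{2}}\binom{r\tau+\frac{r+m}{2}-1}{r-1}$ if $r+m$ is even and $|m|\le r$, and $c_{r,m}(U^\tau)=0$ otherwise; $$b_r^+(U^\tau)=\frac1{r^2}\sum_{d\mid r}\mu\left(\frac rd\right)(-1)^{d\tau}\binom{d(\tau+1)-1}{d-1},$$ $$b_r^-(U^\tau)=\frac1{r^2}\sum_{d\mid r}\mu\left(\frac rd\right)(-1)^{d(\tau+1)}\binom{d\tau-1}{d-1}.$$ Framed twist knots, $p\le-1$: $$b_r^-(\mathcal{K}_p^\tau)=-\frac1{r^2}\sum_{d\mid r}\mu\left(\frac rd\right)(-1)^{d\tau}\binom{d(3-\tau)-1}{d-1},$$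 $$b_r^+(\mathcal{K}_p^\tau)=\frac1{r^2}\sum_{d\mid r}\mu\left(\frac rd\right)(-1)^{d\tau}\binom{d(2|p|+1+\tau)-1}{d-1}.$$ Framed twist knots, $p\ge2$: $$b_r^-(\mathcal{K}_p^\tau)=\frac1{r^2}\sum_{d\mid r}\mu\left(\frac rd\right)(-1)^{d(\tau+1)}\binom{d(\tau+2)-1}{d-1},$$ $$b_r^+(\mathcal{K}_p^\tau)=\frac1{r^2}\sum_{d\mid r}\mu\left(\frac rd\right)(-1)^{d(\tau+1)}\binom{d(\tau+2+2p)-1}{d-1}.$$ *)

theory Defs
  imports "HOL-Computational_Algebra.Computational_Algebra"
begin

definition moebius :: "nat \<Rightarrow> int" where
  "moebius n = (if squarefree n then (-1) ^ card (prime_factors n) else 0)"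

text \<open>
  The upper argument of a binomial coefficient may be a negative integer, so the library's
  generalized binomial coefficient is used, over the rationals. The next two lemmas show that on
  integers it is the usual binomial coefficient, extended to a negative upper argument
  \<open>n\<close> by \<open>(-1)^k\<close> times the binomial coefficient of
  \<open>-n + k - 1\<close> over \<open>k\<close>.
\<close>

lemma gbinomial_of_int_nonneg:
  assumes "n \<ge> 0"
  shows "(rat_of_int n gchoose k) = rat_of_nat (nat n choose k)"
  using assms by (simp add: binomial_gbinomial)

lemma gbinomial_of_int_neg:
  assumes "n < 0"
  shows "(rat_of_int n gchoose k) = (-1) ^ k * rat_of_nat (nat (- n + int k - 1) choose k)"
proof -
  have "rat_of_nat (nat (- n + int k - 1)) = rat_of_nat k - rat_of_int n - 1"
    using assms by simp
  then show ?thesis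
    using gbinomial_negated_upper[of "rat_of_int n" k] by (simp add: binomial_gbinomial)
qed

text \<open>
  Signs have integer, possibly negative, exponents and are written with \<open>powi\<close>.
  The framing is \<open>t\<close>.
\<close>

definition unknot_c :: "int \<Rightarrow> nat \<Rightarrow> int \<Rightarrow> rat" where
  "unknot_c t r m =
     (if even (int r + m) \<and> \<bar>m\<bar> \<le> int r then
        (-1) powi (int r * t + int r + (int r + m) div 2)
          * rat_of_nat (r choose nat ((int r + m) div 2))
          * (rat_of_int (int r * t + (int r + m) div 2 - 1) gchoose (r - 1))
      else 0)"

definition unknot_bps :: "int \<Rightarrow> nat \<Rightarrow> int \<Rightarrow> rat" where
  "unknot_bps t r m =
     1 / (rat_of_nat r)\<^sup>2 *
     (\<Sum>d | d dvd r \<and> int d dvd m. rat_of_int (moebius d) * unknot_c t (r div d) (m div int d))"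

definition unknot_bps_plus :: "int \<Rightarrow> nat \<Rightarrow> rat" where
  "unknot_bps_plus t r =
     1 / (rat_of_nat r)\<^sup>2 *
     (\<Sum>d | d dvd r. rat_of_int (moebius (r div d)) * (-1) powi (int d * t)
        * (rat_of_int (int d * (t + 1) - 1) gchoose (d - 1)))"

definition unknot_bps_minus :: "int \<Rightarrow> nat \<Rightarrow> rat" where
  "unknot_bps_minus t r =
     1 / (rat_of_nat r)\<^sup>2 *
     (\<Sum>d | d dvd r. rat_of_int (moebius (r div d)) * (-1) powi (int d * (t + 1))
        * (rat_of_int (int d * t - 1) gchoose (d - 1)))"

text \<open>
  The formulas for the twist knot \<open>K\<^sub>p\<close> cover only \<open>p \<le> -1\<close> and
  \<open>p \<ge> 2\<close>; the values for \<open>p = 0\<close> and \<open>p = 1\<close> are left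
  unspecified.
\<close>

definition twist_bps_minus :: "int \<Rightarrow> int \<Rightarrow> nat \<Rightarrow> rat" where
  "twist_bps_minus p t r =
     (if p \<le> -1 then
        - (1 / (rat_of_nat r)\<^sup>2) *
        (\<Sum>d | d dvd r. rat_of_int (moebius (r div d)) * (-1) powi (int d * t)
           * (rat_of_int (int d * (3 - t) - 1) gchoose (d - 1)))
      else if p \<ge> 2 then
        1 / (rat_of_nat r)\<^sup>2 *
        (\<Sum>d | d dvd r. rat_of_int (moebius (r div d)) * (-1) powi (int d * (t + 1))
           * (rat_of_int (int d * (t + 2) - 1) gchoose (d - 1)))
      else undefined)"

definition twist_bps_plus :: "int \<Rightarrow> int \<Rightarrow> nat \<Rightarrow> rat" where
  "twist_bps_plus p t r =
     (if p \<le> -1 then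
        1 / (rat_of_nat r)\<^sup>2 *
        (\<Sum>d | d dvd r. rat_of_int (moebius (r div d)) * (-1) powi (int d * t)
           * (rat_of_int (int d * (2 * \<bar>p\<bar> + 1 + t) - 1) gchoose (d - 1)))
      else if p \<ge> 2 then
        1 / (rat_of_nat r)\<^sup>2 *
        (\<Sum>d | d dvd r. rat_of_int (moebius (r div d)) * (-1) powi (int d * (t + 1))
           * (rat_of_int (int d * (t + 2 + 2 * p) - 1) gchoose (d - 1)))
      else undefined)"

end

theory Submission
  imports Defs "HOL-Number_Theory.Cong"
begin

text \<open>
  All five families are instances of one statement. Put
  \<open>g(R, K) = (-1)^(R t + R + K) * binom(R, K) * binom(R t + K - 1, R - 1)\<close>. Then
  \<open>r\<^sup>2\<close> divides the sum of \<open>\<mu>(d) g(r/d, k/d)\<close> over the common divisors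
  \<open>d\<close> of \<open>r\<close> and \<open>k\<close>. For the framed unknot one substitutes
  \<open>m = 2 k - r\<close>; the extremal invariants, of the unknot as well as of the twist knots, are
  the case \<open>k = 0\<close> with a framing \<open>a\<close> whose parity matches the sign in front.

  The divisibility is checked one prime \<open>p\<close> at a time; let \<open>p^\<alpha>\<close> be the exact
  power of \<open>p\<close> in \<open>r\<close>. If \<open>p\<close> does not divide \<open>k\<close>, both binomial
  coefficients of every term are divisible by \<open>p^\<alpha>\<close> by absorption. If \<open>p\<close>
  divides \<open>k\<close>, the terms of \<open>d\<close> and \<open>p d\<close> have opposite Moebius factors, and
  it suffices to show \<open>g(p R, p K) \<equiv> g(R, K)\<close> modulo \<open>p^(2 \<alpha>)\<close> whenever
  \<open>p^\<alpha>\<close> divides \<open>p R\<close> (lemma \<open>bps_num_congruence\<close>).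

  For this congruence write \<open>L = R - K\<close>. Up to a factorial, the second binomial coefficient
  of \<open>g(p R, p K)\<close> is the product of \<open>x + j\<close> over the window \<open>-p L < j < p K\<close>,
  where \<open>x = p R t\<close>. The multiples of \<open>p\<close> in the window give the same product for
  \<open>g(R, K)\<close>, up to a power of \<open>p\<close> that the factorials absorb. So the quotient of the two
  second binomial coefficients is \<open>W(x) / D\<close>, where \<open>W(x)\<close> is the product of
  \<open>x + j\<close> over the \<open>j\<close> prime to \<open>p\<close> and \<open>D\<close> is the product of the positive integers
  prime to \<open>p\<close> below \<open>p R\<close>; and \<open>binom(p R, p K) / binom(R, K)\<close> is, up to sign,
  \<open>D / W(0)\<close>. Thus everything depends on comparing \<open>W(x)\<close> with \<open>W(0)\<close>.

  The window is symmetric under \<open>j \<mapsto> p K - p L - j\<close>, and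
  \<open>(x + j) (x + s - j) = j (s - j) + x (x + s)\<close> with \<open>s = p K - p L\<close>. Hence,
  unless the symmetry has a fixed point prime to \<open>p\<close>,
  \<open>W(x) \<equiv> W(0)\<close> modulo the power of \<open>p\<close> in \<open>x (x + s)\<close>, which has
  exponent at least \<open>\<beta> + \<gamma>\<close>, where \<open>p^\<beta>\<close> is the exact power in
  \<open>p R\<close> and \<open>\<gamma>\<close> is the minimum of \<open>\<beta>\<close> and the exponent for
  \<open>p K\<close> (lemma \<open>unit_prod_cong\<close>). The missing \<open>\<beta> - \<gamma>\<close> powers of
  \<open>p\<close> divide \<open>binom(R, K)\<close>. Such a fixed point exists only for \<open>p = 2\<close> and
  \<open>\<beta> = 1\<close>, and there its factor contributes a sign \<open>(-1)^t\<close>. This sign and that of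
  \<open>W(0)\<close> are exactly those by which \<open>(-1)^(R t + R + K)\<close> changes from \<open>R, K\<close> to
  \<open>p R, p K\<close>.
\<close>

section \<open>Binomial coefficients with integer upper argument\<close>

definition int_gbinomial :: "int \<Rightarrow> nat \<Rightarrow> int"  (infix \<open>zchoose\<close> 64)
  where "a zchoose k = \<lfloor>rat_of_int a gchoose k\<rfloor>"

lemma of_int_gbinomial_and_mult_fact:
  shows of_int_zchoose: "rat_of_int (a zchoose k) = rat_of_int a gchoose k"
    and fact_mult_zchoose: "fact k * (a zchoose k) = (\<Prod>i=0..<k. a - int i)"
proof -
  obtain z :: int where z: "rat_of_int a gchoose k = rat_of_int z"
  proof (cases "a \<ge> 0")
    case True
    show ?thesis
      using gbinomial_of_int_nonneg[OF True, of k] by (intro that[of "int (nat a choose k)"]) simp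
  next
    case False
    with gbinomial_of_int_neg[of a k] show ?thesis
      by (intro that[of "(-1) ^ k * int (nat (- a + int k - 1) choose k)"]) simp
  qed
  have "rat_of_int (fact k * z) = rat_of_int (\<Prod>i=0..<k. a - int i)"
    using gbinomial_mult_fact[of k "rat_of_int a"] by (simp add: z)
  then have *: "fact k * z = (\<Prod>i=0..<k. a - int i)"
    by (simp only: of_int_eq_iff)
  moreover have "a zchoose k = z"
    by (simp add: int_gbinomial_def z)
  ultimately show "rat_of_int (a zchoose k) = rat_of_int a gchoose k"
    and "fact k * (a zchoose k) = (\<Prod>i=0..<k. a - int i)"
    by (simp_all add: z)
qed

text \<open>
  Writing the factors as a window around 0 that depends on \<open>K\<close> and \<open>L\<close> only, shifted by
  \<open>x\<close>, is what makes the symmetry of the factors visible later.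
\<close>

lemma fact_mult_zchoose_eq_window:
  assumes "K + L \<ge> 1"
  shows "fact (K + L - 1) * ((x + int K - 1) zchoose (K + L - 1))
           = (\<Prod>j\<in>{- int L<..<int K}. x + j)"
proof -
  have "(\<Prod>j\<in>{- int L<..<int K}. x + j) = (\<Prod>i=0..<K + L - 1. (x + int K - 1) - int i)"
    by (rule prod.reindex_bij_witness[of _ "\<lambda>i. int K - 1 - int i" "\<lambda>j. nat (int K - 1 - j)"])
      (use assms in auto)
  then show ?thesis
    by (simp add: fact_mult_zchoose)
qed

section \<open>Splitting off the multiples of a prime\<close>

definition unit_window :: "nat \<Rightarrow> nat \<Rightarrow> nat \<Rightarrow> int set" where
  "unit_window p K L = {j. - int L < j \<and> j < int K \<and> \<not> int p dvd j}"

lemma finite_unit_window [simp, intro]: "finite (unit_window p K L)"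
  by (rule finite_subset[of _ "{- int L<..<int K}"]) (auto simp: unit_window_def)

definition unit_prod :: "nat \<Rightarrow> int \<Rightarrow> nat \<Rightarrow> nat \<Rightarrow> int" where
  "unit_prod p x K L = (\<Prod>j\<in>unit_window p K L. x + j)"

definition unit_fact :: "nat \<Rightarrow> nat \<Rightarrow> int" where
  "unit_fact p n = unit_prod p 0 n 0"

lemma window_eq_unit_window_Un_multiples:
  assumes "p > 0"
  shows "{- int (p * L)<..<int (p * K)}
           = unit_window p (p * K) (p * L) \<union> (\<lambda>j. int p * j) ` {- int L<..<int K}" (is "?A = ?U \<union> ?M")
proof (intro set_eqI iffI)
  have pos: "int p > 0" using assms by simp
  fix j assume j: "j \<in> ?A"
  show "j \<in> ?U \<union> ?M"
  proof (cases "int p dvd j")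
    case True
    then obtain i where i: "j = int p * i" ..
    have "int p * (- int L) < int p * i" "int p * i < int p * int K"
      using j i by auto
    then have "- int L < i" "i < int K"
      by (simp_all only: mult_less_cancel_left_pos[OF pos])
    with i show ?thesis by auto
  next
    case False
    with j show ?thesis by (auto simp: unit_window_def)
  qed
next
  have pos: "int p > 0" using assms by simp
  fix j assume "j \<in> ?U \<union> ?M"
  then show "j \<in> ?A"
  proof (elim UnE)
    assume "j \<in> ?U"
    then show ?thesis by (simp add: unit_window_def)
  next
    assume "j \<in> ?M"
    then obtain i where i: "j = int p * i" and "i \<in> {- int L<..<int K}" by blast
    then have "- int L < i" "i < int K" by simp_all
    then have "int p * (- int L) < int p * i" "int p * i < int p * int K"
      by (simp_all only: mult_less_cancel_left_pos[OF pos])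
    with i show ?thesis by simp
  qed
qed

lemma card_window: "K + L \<ge> 1 \<Longrightarrow> card {- int L<..<int K} = K + L - 1"
  by simp

lemma unit_window_Int_multiples:
  "unit_window p A B \<inter> (\<lambda>j. int p * j) ` J = {}"
  by (auto simp: unit_window_def)

text \<open>
  Dividing the multiples of \<open>p\<close> in the window by \<open>p\<close> yields the window for
  \<open>K\<close> and \<open>L\<close>, which has \<open>K + L - 1\<close> elements.
\<close>

lemma prod_window_split:
  assumes "p > 0" "K + L \<ge> 1"
  shows "(\<Prod>j\<in>{- int (p * L)<..<int (p * K)}. int p * x + j)
           = unit_prod p (int p * x) (p * K) (p * L) * int p ^ (K + L - 1)
             * (\<Prod>j\<in>{- int L<..<int K}. x + j)"
proof -
  have inj: "inj_on (\<lambda>j. int p * j) {- int L<..<int K}"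
    using assms by (auto simp: inj_on_def)
  have "(\<Prod>j\<in>{- int (p * L)<..<int (p * K)}. int p * x + j)
      = unit_prod p (int p * x) (p * K) (p * L) * (\<Prod>j\<in>{- int L<..<int K}. int p * x + int p * j)"
    unfolding window_eq_unit_window_Un_multiples[OF assms(1)] unit_prod_def
    by (subst prod.union_disjoint) (auto simp: unit_window_Int_multiples prod.reindex[OF inj])
  also have "(\<Prod>j\<in>{- int L<..<int K}. int p * x + int p * j)
      = (\<Prod>j\<in>{- int L<..<int K}. int p * (x + j))"
    by (simp add: distrib_left)
  also have "\<dots> = int p ^ (K + L - 1) * (\<Prod>j\<in>{- int L<..<int K}. x + j)"
    by (simp only: prod.distrib prod_constant card_window[OF assms(2)])
  finally show ?thesis by simp
qed

lemma fact_pred_eq_window: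
  assumes "n \<ge> 1"
  shows "(\<Prod>j\<in>{- int 0<..<int n}. 0 + j) = fact (n - 1)"
proof -
  have "(\<Prod>j\<in>{- int 0<..<int n}. 0 + j) = (\<Prod>j\<in>{1..n - 1}. int j)"
    by (rule prod.reindex_bij_witness[of _ int nat]) (use assms in auto)
  then show ?thesis
    by (simp add: fact_prod)
qed

lemma fact_mult_split:
  assumes "p > 0"
  shows "fact (p * n) = unit_fact p (p * n) * int p ^ n * fact n"
proof (cases "n = 0")
  case True
  then show ?thesis
    by (auto simp: unit_fact_def unit_prod_def unit_window_def intro!: prod.neutral)
next
  case False
  then have n: "n \<ge> 1" and pn: "p * n \<ge> 1" using assms by auto
  have "fact (p * n) = int (p * n) * fact (p * n - 1)"
    using pn by (simp add: fact_reduce)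
  also have "fact (p * n - 1) = unit_fact p (p * n) * int p ^ (n - 1) * fact (n - 1)"
    using prod_window_split[OF assms, of n 0 0] n
    unfolding unit_fact_def fact_pred_eq_window[OF n, symmetric] fact_pred_eq_window[OF pn, symmetric]
    by simp
  also have "int (p * n) * (unit_fact p (p * n) * int p ^ (n - 1) * fact (n - 1))
      = unit_fact p (p * n) * (int p * int p ^ (n - 1)) * (int n * fact (n - 1))"
    by simp
  also have "int p * int p ^ (n - 1) = int p ^ n"
    using n by (cases n) auto
  also have "int n * fact (n - 1) = fact n"
    using n by (simp add: fact_reduce)
  finally show ?thesis .
qed

text \<open>
  Each of the three factorials \<open>(p n)!\<close> in the binomial coefficient is \<open>p^n n!\<close> times a
  product of integers prime to \<open>p\<close>, and the powers of \<open>p\<close> cancel.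
\<close>

lemma unit_fact_mult_binomial:
  assumes "p > 0"
  shows "unit_fact p (p * K) * unit_fact p (p * L) * int (p * (K + L) choose (p * K))
           = unit_fact p (p * (K + L)) * int ((K + L) choose K)"
proof -
  have binom: "fact A * fact B * int ((A + B) choose A) = fact (A + B)" for A B
    using binomial_fact_lemma[of A "A + B"] by (simp add: of_nat_eq_iff[where 'a = int, symmetric])
  have "(int p ^ (K + L) * fact K * fact L)
          * (unit_fact p (p * K) * unit_fact p (p * L) * int (p * (K + L) choose (p * K)))
      = fact (p * K) * fact (p * L) * int ((p * K + p * L) choose (p * K))"
    by (simp add: fact_mult_split[OF assms] power_add distrib_left)
  also have "\<dots> = fact (p * (K + L))"
    by (simp only: binom distrib_left)
  also have "\<dots> = unit_fact p (p * (K + L)) * int p ^ (K + L) * (fact K * fact L * int ((K + L) choose K))"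
    by (simp only: fact_mult_split[OF assms] binom)
  also have "\<dots> = (int p ^ (K + L) * fact K * fact L)
      * (unit_fact p (p * (K + L)) * int ((K + L) choose K))"
    by (simp only: mult_ac)
  finally show ?thesis
    using assms by simp
qed

text \<open>
  The same cancellation for the other binomial coefficient: its numerator is the shifted window,
  and its denominator is the factorial whose prime-to-\<open>p\<close> part is \<open>unit_fact\<close>.
\<close>

lemma unit_fact_mult_zchoose:
  assumes "p > 0" "K + L \<ge> 1"
  shows "unit_fact p (p * (K + L)) * ((int p * x + int (p * K) - 1) zchoose (p * (K + L) - 1))
           = unit_prod p (int p * x) (p * K) (p * L) * ((x + int K - 1) zchoose (K + L - 1))"
proof -
  define n where "n = K + L"
  have n: "n \<ge> 1" and pn: "p * n \<ge> 1" using assms by (auto simp: n_def)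
  have pKL: "p * K + p * L = p * n" by (simp add: n_def distrib_left)
  let ?G = "(int p * x + int (p * K) - 1) zchoose (p * n - 1)"
  let ?G' = "(x + int K - 1) zchoose (n - 1)"
  have fs: "fact (p * n - 1) = unit_fact p (p * n) * int p ^ (n - 1) * fact (n - 1)"
    using prod_window_split[OF assms(1), of n 0 0] n
    unfolding unit_fact_def fact_pred_eq_window[OF n, symmetric] fact_pred_eq_window[OF pn, symmetric]
    by simp
  have "(int p ^ (n - 1) * fact (n - 1)) * (unit_fact p (p * n) * ?G) = fact (p * n - 1) * ?G"
    unfolding fs by (simp only: mult_ac)
  also have "\<dots> = (\<Prod>j\<in>{- int (p * L)<..<int (p * K)}. int p * x + j)"
    using fact_mult_zchoose_eq_window[of "p * K" "p * L" "int p * x"] pn by (simp only: pKL)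
  also have "\<dots> = unit_prod p (int p * x) (p * K) (p * L) * int p ^ (n - 1) * (fact (n - 1) * ?G')"
    by (simp only: prod_window_split[OF assms] fact_mult_zchoose_eq_window[OF assms(2)] n_def)
  also have "\<dots> = (int p ^ (n - 1) * fact (n - 1)) * (unit_prod p (int p * x) (p * K) (p * L) * ?G')"
    by (simp only: mult_ac)
  finally show ?thesis
    using assms by (simp add: n_def)
qed

text \<open>
  The integer \<open>(-1)^n\<close>, for use in divisibility statements; \<open>powi\<close> takes its values in a
  division ring.
\<close>

definition parity_sign :: "int \<Rightarrow> int" where
  "parity_sign n = (if even n then 1 else - 1)"

lemma parity_sign_add: "parity_sign (m + n) = parity_sign m * parity_sign n"
  by (auto simp: parity_sign_def)

lemma parity_sign_cong: "even (m - n) \<Longrightarrow> parity_sign m = parity_sign n"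
  by (auto simp: parity_sign_def)

text \<open>
  The negative half of the window contributes one sign for each of its \<open>p L - L\<close> elements;
  the elements of the two halves are, in absolute value, the factors of the two \<open>unit_fact\<close>s.
\<close>

lemma unit_prod_0:
  assumes "p > 0"
  shows "unit_prod p 0 (p * K) (p * L)
           = parity_sign (int (p * L) + int L) * unit_fact p (p * K) * unit_fact p (p * L)"
proof -
  let ?P = "\<lambda>n. unit_window p n 0"
  have split: "unit_window p (p * K) (p * L) = ?P (p * K) \<union> uminus ` ?P (p * L)"
  proof (intro set_eqI iffI)
    fix j assume "j \<in> unit_window p (p * K) (p * L)"
    then have *: "j \<noteq> 0" "- int (p * L) < j" "j < int (p * K)" "\<not> int p dvd j"
      by (auto simp: unit_window_def)
    show "j \<in> ?P (p * K) \<union> uminus ` ?P (p * L)"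
    proof (cases "j > 0")
      case True
      with * show ?thesis by (auto simp: unit_window_def)
    next
      case False
      with * have "- j \<in> ?P (p * L)" by (auto simp: unit_window_def)
      then have "- (- j) \<in> uminus ` ?P (p * L)" by blast
      then show ?thesis by simp
    qed
  next
    fix j assume "j \<in> ?P (p * K) \<union> uminus ` ?P (p * L)"
    then show "j \<in> unit_window p (p * K) (p * L)"
    proof (elim UnE imageE)
      assume "j \<in> ?P (p * K)"
      moreover have "0 \<le> int (p * L)" by simp
      ultimately show ?thesis unfolding unit_window_def mem_Collect_eq by linarith
    next
      fix i assume "j = - i" "i \<in> ?P (p * L)"
      moreover from this have "- i < int (p * K)"
        using of_nat_0_le_iff[of "p * K"] unfolding unit_window_def mem_Collect_eq by linarith
      ultimately show ?thesis
        unfolding unit_window_def by simp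
    qed
  qed
  have card: "card (?P (p * L)) = p * L - L"
  proof (cases "L = 0")
    case False
    then have L: "L + 0 \<ge> 1" "p * L + 0 \<ge> 1" using assms by auto
    have inj: "inj_on (\<lambda>j. int p * j) {- int 0<..<int L}"
      using assms by (auto simp: inj_on_def)
    have "card {- int (p * 0)<..<int (p * L)}
        = card (?P (p * L)) + card ((\<lambda>j. int p * j) ` {- int 0<..<int L})"
      unfolding window_eq_unit_window_Un_multiples[OF assms, of 0 L]
      by (subst card_Un_disjoint) (auto simp: unit_window_Int_multiples)
    then have "p * L - 1 = card (?P (p * L)) + (L - 1)"
      by (simp only: card_image[OF inj] card_window[OF L(1)] card_window[OF L(2)] add_0_right mult_0_right)
    with L show ?thesis by simp
  qed (auto simp: unit_window_def intro!: card_eq_0_iff[THEN iffD2])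
  have "unit_prod p 0 (p * K) (p * L) = (\<Prod>j\<in>?P (p * K). j) * (\<Prod>j\<in>uminus ` ?P (p * L). j)"
    unfolding unit_prod_def split
    by (subst prod.union_disjoint[OF finite_unit_window finite_imageI[OF finite_unit_window]])
      (auto simp: unit_window_def)
  also have "(\<Prod>j\<in>uminus ` ?P (p * L). j) = (\<Prod>j\<in>?P (p * L). - 1 * j)"
    by (subst prod.reindex) (auto simp: inj_on_def)
  also have "\<dots> = (- 1) ^ (p * L - L) * (\<Prod>j\<in>?P (p * L). j)"
    by (simp only: prod.distrib prod_constant card)
  also have "(- 1) ^ (p * L - L) = parity_sign (int (p * L) + int L)"
    using assms by (auto simp: parity_sign_def minus_one_power_iff)
  finally show ?thesis
    by (simp add: unit_fact_def unit_prod_def)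
qed

lemma coprime_unit_fact:
  assumes "prime p"
  shows "coprime (int p ^ e) (unit_fact p n)"
  unfolding unit_fact_def unit_prod_def
proof (intro prod_coprime_right)
  fix j assume "j \<in> unit_window p n 0"
  then have "\<not> int p dvd j" by (simp add: unit_window_def)
  then show "coprime (int p ^ e) (0 + j)"
    using assms by (auto intro!: prime_imp_coprime)
qed

section \<open>The reflection of the window\<close>

lemma prod_reflect:
  fixes f :: "int \<Rightarrow> int"
  assumes "finite J" and refl: "\<And>j. j \<in> J \<Longrightarrow> s - j \<in> J"
  shows "prod f J = (\<Prod>j | j \<in> J \<and> 2 * j < s. f j * f (s - j)) * (\<Prod>j | j \<in> J \<and> 2 * j = s. f j)"
proof -
  have "J = ({j \<in> J. 2 * j < s} \<union> {j \<in> J. 2 * j > s}) \<union> {j \<in> J. 2 * j = s}" by auto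
  then have "prod f J = prod f (({j \<in> J. 2 * j < s} \<union> {j \<in> J. 2 * j > s}) \<union> {j \<in> J. 2 * j = s})"
    by simp
  also have "\<dots> = prod f {j \<in> J. 2 * j < s} * prod f {j \<in> J. 2 * j > s} * prod f {j \<in> J. 2 * j = s}"
    using assms(1) by (subst prod.union_disjoint; (subst prod.union_disjoint)?) auto
  also have "prod f {j \<in> J. 2 * j > s} = (\<Prod>j | j \<in> J \<and> 2 * j < s. f (s - j))"
    by (rule prod.reindex_bij_witness[of _ "\<lambda>j. s - j" "\<lambda>j. s - j"]) (use refl in auto)
  finally show ?thesis
    by (simp add: prod.distrib)
qed

text \<open>
  The reflection \<open>j \<mapsto> s - j\<close> with \<open>s = K - L\<close> preserves the window, and a pair
  of reflected factors changes only by \<open>x (x + s)\<close> when \<open>0\<close> is replaced by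
  \<open>x\<close>. Since \<open>s = 2 K - R\<close>, the factor \<open>x + s\<close> is divisible by
  \<open>p^c\<close>, and \<open>x\<close> is divisible by \<open>p^a\<close>. A fixed point \<open>j = s/2\<close> that is
  not a multiple of \<open>p\<close> forces \<open>p = 2\<close> and \<open>R/2\<close> odd; the sign on the right is
  \<open>-1\<close> exactly if in addition \<open>t\<close> is odd.
\<close>

lemma unit_prod_cong:
  assumes "prime p" "p dvd K" "p dvd L" and R: "R = K + L" "R > 0"
    and a: "p ^ a dvd R" "\<not> p ^ Suc a dvd R" and c: "c \<le> a" "c \<ge> 1" "p ^ c dvd K"
    and x: "x = int R * t"
  shows "[unit_prod p x K L = parity_sign (int (R + R div p) * t) * unit_prod p 0 K L] (mod int p ^ (a + c))"
proof -
  define J where "J = unit_window p K L"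
  define s where "s = int K - int L"
  have p: "p > 1" using assms(1) by (rule prime_gt_1_nat)
  have refl: "s - j \<in> J" if "j \<in> J" for j
  proof -
    have "int p dvd s" using assms(2,3) by (simp add: s_def)
    then have "int p dvd s - j \<longleftrightarrow> int p dvd j"
      by (metis diff_diff_eq2 dvd_diff add_diff_cancel_left' dvd_diff_commute)
    with that show ?thesis by (auto simp: J_def unit_window_def s_def)
  qed
  have fin: "finite J" by (simp add: J_def)
  have M: "int p ^ (a + c) dvd x * (x + s)"
  proof -
    have R1: "int p ^ a dvd int R" using a(1) by (metis of_nat_dvd_iff of_nat_power)
    then have R2: "int p ^ c dvd int R" using c(1) by (meson dvd_trans le_imp_power_dvd)
    have K: "int p ^ c dvd int K" using c(3) by (metis of_nat_dvd_iff of_nat_power)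
    have "s = 2 * int K - int R" using R by (simp add: s_def)
    then have "int p ^ c dvd x + s" using R2 K x by simp
    moreover have "int p ^ a dvd x" using R1 x by simp
    ultimately show ?thesis by (simp add: power_add mult_dvd_mono)
  qed
  have pairs: "[(\<Prod>j | j \<in> J \<and> 2 * j < s. (x + j) * (x + (s - j)))
      = (\<Prod>j | j \<in> J \<and> 2 * j < s. (0 + j) * (0 + (s - j)))] (mod int p ^ (a + c))"
  proof (rule cong_prod)
    fix j
    have "(x + j) * (x + (s - j)) - (0 + j) * (0 + (s - j)) = x * (x + s)"
      by (simp add: algebra_simps)
    with M show "[(x + j) * (x + (s - j)) = (0 + j) * (0 + (s - j))] (mod int p ^ (a + c))"
      by (simp only: cong_iff_dvd_diff)
  qed
  have centre: "[(\<Prod>j | j \<in> J \<and> 2 * j = s. x + j)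
      = parity_sign (int (R + R div p) * t) * (\<Prod>j | j \<in> J \<and> 2 * j = s. 0 + j)] (mod int p ^ (a + c))"
  proof (cases "p = 2 \<and> a = 1")
    case True
    then have pa: "p = 2" "a = 1" "c = 1" using c by auto
    obtain R' where R': "R = 2 * R'" "odd R'"
      using a pa by (auto elim!: dvdE)
    define j0 where "j0 = int K - int R'"
    have K: "even K" "even L" using assms(2,3) pa by auto
    have j0: "2 * j0 = s" "odd j0" using R R' K by (auto simp: j0_def s_def)
    have "{j. j \<in> J \<and> 2 * j = s} = {j0}"
      using j0 R R' \<open>R > 0\<close> pa by (auto simp: J_def unit_window_def j0_def)
    (* Modulo 4, x = 2 R' t with R' odd: it vanishes for even t, and for odd t it is 2, which
       turns the odd number j0 into its negative. *)
    moreover have "[x + j0 = parity_sign (int (R + R div p) * t) * (0 + j0)] (mod 4)"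
    proof (cases "even t")
      case True
      then obtain u where "t = 2 * u" ..
      then show ?thesis using R' x by (simp add: parity_sign_def cong_iff_dvd_diff)
    next
      case False
      then obtain u v where "t = 2 * u + 1" "j0 = 2 * v + 1" using j0 by (auto elim!: oddE)
      moreover obtain w where "R' = 2 * w + 1" using R' by (auto elim!: oddE)
      ultimately show ?thesis using R' x pa
        by (simp add: parity_sign_def cong_iff_dvd_diff algebra_simps)
    qed
    ultimately show ?thesis using pa by simp
  next
    case False
    have "{j. j \<in> J \<and> 2 * j = s} = {}"
    proof (rule ccontr)
      assume "{j. j \<in> J \<and> 2 * j = s} \<noteq> {}"
      then obtain j where j: "j \<in> J" "2 * j = s" by auto
      then have nd: "\<not> int p dvd j" by (simp add: J_def unit_window_def)
      have ds: "int p dvd 2 * j" unfolding j(2) using assms(2,3) by (simp add: s_def)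
      have pr: "prime (int p)" using assms(1) by simp
      with ds nd have "int p dvd 2" by (simp add: prime_dvd_mult_iff)
      then have "p dvd 2" by presburger
      then have p2: "p = 2" using p by (auto dest: dvd_imp_le)
      with False c have "a \<ge> 2" by auto
      then have "4 dvd R" using a(1) p2 le_imp_power_dvd[of 2 a "2::nat"] by (auto intro: dvd_trans)
      moreover have "even K" using assms(2) p2 by simp
      moreover have "2 * j = 2 * int K - int R" using j(2) R by (simp add: s_def)
      ultimately have "even j" by presburger
      with nd p2 show False by simp
    qed
    moreover have "even (R + R div p)"
    proof (cases "p = 2")
      case True
      with False c have "a \<ge> 2" by auto
      then have "4 dvd R" using a(1) True le_imp_power_dvd[of 2 a "2::nat"] by (auto intro: dvd_trans)
      with True show ?thesis by (auto elim!: dvdE)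
    next
      case pn2: False
      then have "odd p" using assms(1) p prime_odd_nat[of p] by auto
      moreover have "p dvd R" using assms(2,3) R by simp
      then have "R = p * (R div p)" by (simp only: dvd_mult_div_cancel)
      ultimately show ?thesis by (metis even_add even_mult_iff)
    qed
    then have "parity_sign (int (R + R div p) * t) = 1"
      unfolding parity_sign_def by (simp only: even_mult_iff even_of_nat simp_thms if_True)
    ultimately show ?thesis by (simp only: prod.empty mult_1 cong_refl)
  qed
  have "(\<Prod>j\<in>J. y + j) = (\<Prod>j | j \<in> J \<and> 2 * j < s. (y + j) * (y + (s - j)))
      * (\<Prod>j | j \<in> J \<and> 2 * j = s. y + j)" for y
    by (rule prod_reflect[OF fin refl])
  then show ?thesis
    unfolding unit_prod_def J_def[symmetric]
    using cong_mult[OF pairs centre] by (simp only: mult_ac)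
qed

section \<open>The congruence for the numerators of the BPS invariants\<close>

definition bps_num :: "int \<Rightarrow> nat \<Rightarrow> nat \<Rightarrow> int" where
  "bps_num t R K = parity_sign (int R * t + int R + int K) * int (R choose K)
     * ((int R * t + int K - 1) zchoose (R - 1))"

text \<open>
  Absorption, \<open>K * binom(R, K) = R * binom(R - 1, K - 1)\<close>: of the \<open>a\<close> factors
  \<open>p\<close> on the right, at most \<open>c\<close> can be accounted for by \<open>K\<close>.
\<close>

lemma prime_power_dvd_binomial:
  assumes "prime p" "p ^ a dvd R" "\<not> p ^ Suc c dvd K" "c \<le> a"
  shows "p ^ (a - c) dvd (R choose K)"
proof -
  have K: "K > 0" using assms(3) by (cases K) auto
  have "K * (R choose K) = R * ((R - 1) choose (K - 1))"
    using K by (metis Suc_pred' Suc_times_binomial_eq binomial_eq_0_iff bot_nat_0.extremum_strict mult.commute times_binomial_minus1_eq)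
  then have d: "p ^ a dvd K * (R choose K)" using assms(2) by simp
  show ?thesis
  proof (cases "R choose K = 0")
    case True
    then show ?thesis by (simp only: dvd_0_right)
  next
    case False
    have "a \<le> multiplicity p (K * (R choose K))"
      using d False K assms(1) by (subst (asm) power_dvd_iff_le_multiplicity) (auto simp: prime_gt_1_nat)
    also have "\<dots> = multiplicity p K + multiplicity p (R choose K)"
      using False K assms(1) by (simp add: prime_elem_multiplicity_mult_distrib)
    also have "multiplicity p K < Suc c"
      using assms(1,3) K by (metis multiplicity_dvd' not_less)
    finally show ?thesis
      by (intro multiplicity_dvd') auto
  qed
qed

text \<open>
  Again absorption, \<open>N * binom(N - 1, R - 1) = R * binom(N, R)\<close>, now with a factor
  \<open>N\<close> prime to \<open>p\<close>.
\<close>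

lemma prime_power_dvd_zchoose:
  assumes "prime p" "p ^ a dvd R" "R \<ge> 1" "\<not> int p dvd N"
  shows "int p ^ a dvd (N - 1) zchoose (R - 1)"
proof -
  have "rat_of_int (N * ((N - 1) zchoose (R - 1))) = rat_of_int (int R * (N zchoose R))"
    using gbinomial_absorption[of "R - 1" "rat_of_int N"] assms(3) by (simp add: of_int_zchoose)
  then have "N * ((N - 1) zchoose (R - 1)) = int R * (N zchoose R)"
    by (simp only: of_int_eq_iff)
  moreover have "int p ^ a dvd int R" using assms(2) by (metis of_nat_dvd_iff of_nat_power)
  ultimately have "int p ^ a dvd N * ((N - 1) zchoose (R - 1))" by simp
  moreover have "coprime (int p ^ a) N"
    using assms(1,4) by (auto intro!: prime_imp_coprime)
  ultimately show ?thesis by (simp add: coprime_dvd_mult_right_iff)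
qed

lemma prime_power_dvd_bps_num:
  assumes "prime p" "p ^ a dvd R" "R \<ge> 1" "p dvd R" "\<not> p dvd K"
  shows "int p ^ (2 * a) dvd bps_num t R K"
proof -
  have "p ^ a dvd (R choose K)"
    using prime_power_dvd_binomial[OF assms(1,2), of 0 K] assms(5) by simp
  then have 1: "int p ^ a dvd int (R choose K)" by (metis of_nat_dvd_iff of_nat_power)
  have "int p dvd int R * t" using assms(4) by simp
  then have "\<not> int p dvd int R * t + int K" using assms(5) by (simp add: dvd_add_right_iff)
  with prime_power_dvd_zchoose[OF assms(1-3)] have 2: "int p ^ a dvd (int R * t + int K - 1) zchoose (R - 1)"
    by blast
  have "2 * a = a + a" by simp
  then show ?thesis
    unfolding bps_num_def using mult_dvd_mono[OF 1 2]
    by (simp only: power_add mult.assoc dvd_mult)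
qed

text \<open>
  With \<open>C\<close> and \<open>C'\<close> the unsigned values of the two sides and \<open>F\<close> a product of
  integers prime to \<open>p\<close>, splitting off the multiples of \<open>p\<close> gives
  \<open>F C = W C'\<close>, and the reflection gives \<open>W \<equiv> \<plusminus>F\<close> modulo
  \<open>p^(b + c)\<close>. Therefore \<open>F (C \<mp> C')\<close> is divisible by \<open>p^(b + c)\<close> times the
  power \<open>p^(b - c)\<close> contained in \<open>C'\<close>, and \<open>F\<close> can be cancelled.
\<close>

lemma bps_num_congruence:
  assumes "prime p" "p ^ a dvd p * R" "R \<ge> 1" "K \<le> R"
  shows "int p ^ (2 * a) dvd bps_num t (p * R) (p * K) - bps_num t R K"
proof -
  have p: "p > 1" using assms(1) by (rule prime_gt_1_nat)
  define L where "L = R - K"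
  have R: "R = K + L" using assms(4) by (simp add: L_def)
  define b where "b = multiplicity p (p * R)"
  have pR0: "p * R \<noteq> 0" using p assms(3) by simp
  have unit: "\<not> is_unit p" using p by simp
  have b: "p ^ b dvd p * R" "\<not> p ^ Suc b dvd p * R"
    using power_dvd_iff_le_multiplicity[OF pR0 unit, of b] power_dvd_iff_le_multiplicity[OF pR0 unit, of "Suc b"]
    unfolding b_def by simp_all
  have ab: "a \<le> b"
    using assms(2) power_dvd_iff_le_multiplicity[OF pR0 unit, of a] by (simp only: b_def)
  have b1: "b \<ge> 1"
    using power_dvd_iff_le_multiplicity[OF pR0 unit, of 1] by (simp only: b_def power_one_right dvd_triv_left)
  (* c is the minimum of b and the exponent of p in p K. The minimum matters: K may be 0, or
     contain more factors p than R. *)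
  obtain c where c: "c \<le> b" "c \<ge> 1" "p ^ c dvd p * K" "c = b \<or> \<not> p ^ Suc c dvd p * K"
  proof (cases "p ^ b dvd p * K")
    case True
    then show ?thesis using that[of b] b1 by simp
  next
    case False
    then have K0: "p * K \<noteq> 0" by (metis dvd_0_right)
    show ?thesis
    proof (rule that[of "multiplicity p (p * K)"])
      show "multiplicity p (p * K) \<le> b"
        using False by (metis multiplicity_dvd' nat_le_linear)
      show "multiplicity p (p * K) \<ge> 1"
        using power_dvd_iff_le_multiplicity[OF K0 unit, of 1] by (simp only: power_one_right dvd_triv_left)
      show "p ^ multiplicity p (p * K) dvd p * K"
        by (rule multiplicity_dvd)
      show "multiplicity p (p * K) = b \<or> \<not> p ^ Suc (multiplicity p (p * K)) dvd p * K"
        using power_dvd_iff_le_multiplicity[OF K0 unit] by (simp only: not_less_eq_eq) simp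
    qed
  qed
  define x where "x = int (p * R) * t"
  define s where "s = parity_sign (int (p * R + R) * t)"
  define s' where "s' = parity_sign (int (p * L) + int L)"
  define C where "C = int (p * R choose (p * K)) * ((x + int (p * K) - 1) zchoose (p * R - 1))"
  define C' where "C' = int (R choose K) * ((int R * t + int K - 1) zchoose (R - 1))"
  define F where "F = unit_fact p (p * K) * unit_fact p (p * L)"
  define FR where "FR = unit_fact p (p * R)"
  define W where "W = unit_prod p x (p * K) (p * L)"
  have key: "F * C = W * C'"
  proof -
    have "FR * (F * C) = (F * int (p * R choose (p * K))) * (FR * ((x + int (p * K) - 1) zchoose (p * R - 1)))"
      by (simp only: C_def mult_ac)
    also have "F * int (p * R choose (p * K)) = FR * int (R choose K)"
      using unit_fact_mult_binomial[of p K L] p by (simp add: F_def FR_def R)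
    also have "FR * ((x + int (p * K) - 1) zchoose (p * R - 1))
        = W * ((int R * t + int K - 1) zchoose (R - 1))"
      using unit_fact_mult_zchoose[of p K L "int R * t"] p assms(3)
      by (simp add: FR_def W_def x_def R mult.assoc)
    finally have "FR * (F * C) = FR * (W * C')" by (simp only: C'_def mult_ac)
    moreover have "FR \<noteq> 0"
      using coprime_unit_fact[OF assms(1), of 1 "p * R"] p by (auto simp: FR_def)
    ultimately show ?thesis by simp
  qed
  have "[W = s * (s' * F)] (mod int p ^ (b + c))"
  proof -
    have "unit_prod p 0 (p * K) (p * L) = s' * F"
      using unit_prod_0[of p K L] p by (simp add: s'_def F_def)
    moreover have "[unit_prod p x (p * K) (p * L)
        = parity_sign (int (p * R + p * R div p) * t) * unit_prod p 0 (p * K) (p * L)] (mod int p ^ (b + c))"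
      by (rule unit_prod_cong[OF assms(1) _ _ _ _ b c(1-3) x_def])
        (use p assms(3) in \<open>auto simp: R distrib_left\<close>)
    moreover have "p * R div p = R" using p by simp
    ultimately show ?thesis by (simp only: W_def s_def)
  qed
  (* Passing from p R, p K to R, K lowers both exponents by one, so their difference stays b - c. *)
  moreover have "int p ^ (b - c) dvd C'"
  proof (cases "c = b")
    case False
    have "p ^ Suc (b - 1) dvd p * R"
      using b(1) b1 by simp
    then have "p ^ (b - 1) dvd R"
      using p by simp
    moreover have "\<not> p ^ Suc (c - 1) dvd K"
      using False c p by (cases c) auto
    ultimately have "p ^ ((b - 1) - (c - 1)) dvd (R choose K)"
      by (rule prime_power_dvd_binomial[OF assms(1)]) (use c(1) in simp)
    moreover have "(b - 1) - (c - 1) = b - c" using c by simp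
    ultimately have "p ^ (b - c) dvd (R choose K)" by (simp only:)
    then show ?thesis unfolding C'_def by (metis dvd_mult2 of_nat_dvd_iff of_nat_power)
  qed simp
  ultimately have "int p ^ (b + c) * int p ^ (b - c) dvd (W - s * (s' * F)) * C'"
    by (intro mult_dvd_mono) (simp_all add: cong_iff_dvd_diff)
  moreover have "int p ^ (b + c) * int p ^ (b - c) = int p ^ (2 * b)"
  proof -
    have "(b + c) + (b - c) = 2 * b" using c(1) by simp
    then show ?thesis by (simp only: power_add[symmetric])
  qed
  moreover have "(W - s * (s' * F)) * C' = F * (C - s * s' * C')"
    using key by (simp add: algebra_simps)
  ultimately have "int p ^ (2 * b) dvd F * (C - s * s' * C')" by simp
  moreover have "coprime (int p ^ (2 * b)) F"
    unfolding F_def using coprime_unit_fact[OF assms(1)] by (intro coprime_mult_right_iff[THEN iffD2]) auto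
  ultimately have "int p ^ (2 * b) dvd C - s * s' * C'"
    by (simp add: coprime_dvd_mult_right_iff)
  moreover have "int p ^ (2 * a) dvd int p ^ (2 * b)" using ab by (intro le_imp_power_dvd) simp
  ultimately have main: "int p ^ (2 * a) dvd C - s * s' * C'" by (rule dvd_trans[rotated])
  define e where "e = parity_sign (x + int (p * R) + int (p * K))"
  have "bps_num t (p * R) (p * K) - bps_num t R K = e * (C - s * s' * C')"
  proof -
    have "parity_sign (int R * t + int R + int K) = e * (s * s')"
      unfolding e_def s_def s'_def parity_sign_add[symmetric]
    proof (rule parity_sign_cong)
      have "int R * t + int R + int K - (x + int (p * R) + int (p * K)
              + (int (p * R + R) * t + (int (p * L) + int L)))
          = 2 * (int K - int (p * R) * t - int (p * R))"
        by (simp add: x_def R algebra_simps)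
      then show "even (int R * t + int R + int K - (x + int (p * R) + int (p * K)
              + (int (p * R + R) * t + (int (p * L) + int L))))"
        by (simp only: dvd_triv_left)
    qed
    then have "bps_num t R K = e * (s * s') * C'"
      by (simp only: bps_num_def C'_def mult.assoc)
    moreover have "bps_num t (p * R) (p * K) = e * C"
      by (simp only: bps_num_def C_def e_def x_def mult.assoc)
    ultimately show ?thesis by (simp add: right_diff_distrib mult.assoc)
  qed
  with main show ?thesis by simp
qed

section \<open>Summation against the Moebius function\<close>

lemma moebius_prime_mult:
  assumes "prime p" "d > 0"
  shows "moebius (p * d) = (if p dvd d then 0 else - moebius d)"
proof (cases "p dvd d")
  case True
  then have "p\<^sup>2 dvd p * d" by (simp add: power2_eq_square)
  then have "\<not> squarefree (p * d)"
    using assms(1) by (metis not_prime_unit squarefreeD)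
  with True show ?thesis by (simp add: moebius_def)
next
  case False
  then have cop: "coprime p d" using assms(1) by (simp add: prime_imp_coprime)
  have "squarefree (p * d) \<longleftrightarrow> squarefree d"
    using cop assms(1) by (meson squarefree_multD(2) squarefree_mult_coprime squarefree_prime)
  moreover have "prime_factors (p * d) = insert p (prime_factors d)"
    using assms by (simp add: prime_factors_product prime_prime_factors)
  moreover have "p \<notin> prime_factors d" using False by auto
  ultimately show ?thesis using False by (simp add: moebius_def)
qed

text \<open>
  A divisor with \<open>p\<^sup>2 | d\<close> contributes nothing, and the remaining divisors come in pairs
  \<open>d\<close>, \<open>p d\<close> with \<open>\<mu>(p d) = - \<mu>(d)\<close>.
\<close>

lemma sum_moebius_prime:
  fixes h :: "nat \<Rightarrow> int"
  assumes "prime p" "p dvd n" "n > 0"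
  shows "(\<Sum>d | d dvd n. moebius d * h d)
           = (\<Sum>d | d dvd n \<and> \<not> p dvd d. moebius d * (h d - h (p * d)))"
proof -
  have p: "p > 0" using assms(1) by (rule prime_gt_0_nat)
  have fin: "finite {d. d dvd n}" using assms(3) by simp
  have pd: "p * d dvd n" if "d dvd n" "\<not> p dvd d" for d
    using that assms by (intro divides_mult) (auto intro: prime_imp_coprime)
  have split: "{d. d dvd n} = {d. d dvd n \<and> \<not> p dvd d} \<union> {d. d dvd n \<and> p dvd d}" by auto
  have "(\<Sum>d | d dvd n. moebius d * h d) = (\<Sum>d | d dvd n \<and> \<not> p dvd d. moebius d * h d)
      + (\<Sum>d | d dvd n \<and> p dvd d. moebius d * h d)"
    by (subst split, rule sum.union_disjoint) (use fin in auto)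
  also have "(\<Sum>d | d dvd n \<and> p dvd d. moebius d * h d)
      = (\<Sum>d\<in>(\<lambda>d. p * d) ` {d. d dvd n \<and> \<not> p dvd d}. moebius d * h d)"
  proof (rule sum.mono_neutral_right)
    show "\<forall>i\<in>{d. d dvd n \<and> p dvd d} - (\<lambda>d. p * d) ` {d. d dvd n \<and> \<not> p dvd d}. moebius i * h i = 0"
    proof
      fix i assume i: "i \<in> {d. d dvd n \<and> p dvd d} - (\<lambda>d. p * d) ` {d. d dvd n \<and> \<not> p dvd d}"
      then have "p dvd i" by simp
      then obtain d where d: "i = p * d" by (rule dvdE)
      from i have "p * d dvd n" by (simp add: d)
      then have "d dvd n" by (rule dvd_mult_right)
      with i have "p dvd d" unfolding d by blast
      moreover have "d > 0" using \<open>d dvd n\<close> assms(3) by (auto intro: Nat.gr0I)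
      ultimately show "moebius i * h i = 0"
        using moebius_prime_mult[OF assms(1), of d] d by simp
    qed
    show "finite {d. d dvd n \<and> p dvd d}"
      using fin by (rule rev_finite_subset) blast
    show "(\<lambda>d. p * d) ` {d. d dvd n \<and> \<not> p dvd d} \<subseteq> {d. d dvd n \<and> p dvd d}"
      using pd by (intro image_subsetI CollectI conjI dvd_triv_left) blast
  qed
  also have "\<dots> = (\<Sum>d | d dvd n \<and> \<not> p dvd d. moebius (p * d) * h (p * d))"
    using p by (subst sum.reindex) (auto simp: inj_on_def)
  also have "\<dots> = (\<Sum>d | d dvd n \<and> \<not> p dvd d. - (moebius d * h (p * d)))"
  proof (intro sum.cong refl)
    fix d assume "d \<in> {d. d dvd n \<and> \<not> p dvd d}"
    moreover from this have "d > 0" using assms(3) by (auto intro: Nat.gr0I)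
    ultimately show "moebius (p * d) * h (p * d) = - (moebius d * h (p * d))"
      using moebius_prime_mult[OF assms(1), of d] by simp
  qed
  finally show ?thesis
    by (simp only: sum_negf sum_subtractf right_diff_distrib add_uminus_conv_diff)
qed

text \<open>
  It suffices to find, for each prime divisor \<open>p\<close> of \<open>r\<close>, twice its exponent in
  \<open>r\<close>. If \<open>p\<close> does not divide \<open>k\<close>, every single term has it. Otherwise the
  terms are paired, and since \<open>p\<close> does not divide \<open>d\<close>, the argument \<open>r/d\<close> still
  contains the full power of \<open>p\<close>.
\<close>

lemma square_dvd_moebius_sum:
  assumes "r \<ge> 1" "k \<le> r"
  shows "(int r)\<^sup>2 dvd (\<Sum>d | d dvd gcd r k. moebius d * bps_num t (r div d) (k div d))" (is "_ dvd ?S")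
proof -
  let ?n = "gcd r k"
  have n: "?n > 0" using assms by simp
  have div_pos: "r div d \<ge> 1" if "d dvd r" for d
    using that assms(1) by (auto simp: Suc_le_eq div_greater_zero_iff dvd_imp_le intro: Nat.gr0I)
  have pow: "int p ^ (2 * multiplicity p r) dvd ?S" if p: "prime p" "p dvd r" for p
  proof -
    define a where "a = multiplicity p r"
    have ar: "p ^ a dvd r" by (simp add: a_def multiplicity_dvd)
    have quot: "p ^ a dvd r div d" "r div d \<ge> 1" "p dvd r div d" if d: "d dvd r" "\<not> p dvd d" for d
    proof -
      have *: "p ^ e dvd r div d" if "p ^ e dvd r" for e
      proof -
        have "coprime (p ^ e) d" using p d by (auto intro!: prime_imp_coprime)
        moreover have "p ^ e dvd (r div d) * d" using that d by simp
        ultimately show ?thesis by (simp add: coprime_dvd_mult_left_iff)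
      qed
      show "p ^ a dvd r div d" using * ar .
      show "p dvd r div d" using *[of 1] p by simp
    qed (use div_pos d in auto)
    show ?thesis
      unfolding a_def[symmetric]
    proof (cases "p dvd k")
      case False
      show "int p ^ (2 * a) dvd ?S"
      proof (intro dvd_sum dvd_mult)
        fix d assume "d \<in> {d. d dvd ?n}"
        then have d: "d dvd r" "d dvd k" by auto
        moreover from d False have "\<not> p dvd d" by (meson dvd_trans)
        moreover from d False have "\<not> p dvd k div d" by (metis dvd_mult dvd_mult_div_cancel)
        ultimately show "int p ^ (2 * a) dvd bps_num t (r div d) (k div d)"
          using quot p by (intro prime_power_dvd_bps_num) auto
      qed
    next
      case True
      then have pn: "p dvd ?n" using p by simp
      show "int p ^ (2 * a) dvd ?S"
        unfolding sum_moebius_prime[OF p(1) pn n]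
      proof (intro dvd_sum dvd_mult)
        fix d assume "d \<in> {d. d dvd ?n \<and> \<not> p dvd d}"
        then have d: "d dvd r" "d dvd k" "\<not> p dvd d" by auto
        have "p * d dvd ?n"
          using d p pn by (intro divides_mult) (auto intro: prime_imp_coprime)
        then have "p * d dvd r" "p * d dvd k" by auto
        then obtain R K where RK: "r = p * d * R" "k = p * d * K" by (auto elim!: dvdE)
        have pos: "p > 0" "d > 0" "R > 0" using RK(1) assms(1) by (auto intro!: Nat.gr0I)
        have "K \<le> R" using assms(2) pos unfolding RK by simp
        moreover have "r div d = p * R" "k div d = p * K" "r div (p * d) = R" "k div (p * d) = K"
          using pos by (simp_all add: RK)
        moreover have "p ^ a dvd p * R" using quot(1)[OF d(1,3)] \<open>r div d = p * R\<close> by simp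
        ultimately show "int p ^ (2 * a) dvd
            bps_num t (r div d) (k div d) - bps_num t (r div (p * d)) (k div (p * d))"
          using bps_num_congruence[OF p(1), of a R K t] pos by simp
      qed
    qed
  qed
  show ?thesis
  proof (cases "?S = 0")
    case False
    have "r\<^sup>2 dvd nat \<bar>?S\<bar>"
    proof (rule multiplicity_le_imp_dvd)
      fix p :: nat assume p: "prime p"
      show "multiplicity p (r\<^sup>2) \<le> multiplicity p (nat \<bar>?S\<bar>)"
      proof (cases "p dvd r")
        case True
        have "int (p ^ (2 * multiplicity p r)) dvd ?S" using pow[OF p True] by simp
        then have "p ^ (2 * multiplicity p r) dvd nat \<bar>?S\<bar>" by (simp only: dvd_nat_abs_iff)
        then have "2 * multiplicity p r \<le> multiplicity p (nat \<bar>?S\<bar>)"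
          using False p by (subst (asm) power_dvd_iff_le_multiplicity) auto
        then show ?thesis
          using p assms(1) by (simp add: prime_elem_multiplicity_power_distrib)
      next
        case False
        then have "multiplicity p (r\<^sup>2) = 0"
          using p by (intro not_dvd_imp_multiplicity_0) (auto dest: prime_dvd_power)
        then show ?thesis by simp
      qed
    qed (use assms in auto)
    then have "int (r\<^sup>2) dvd ?S" by (simp only: dvd_nat_abs_iff)
    then show ?thesis by simp
  qed simp
qed

section \<open>Integrality of the invariants\<close>

lemma powi_eq_parity_sign: "(- 1 :: rat) powi e = of_int (parity_sign e)"
  by (auto simp: parity_sign_def power_int_minus_left)

lemma of_int_bps_num_0:
  "rat_of_int (bps_num a d 0) = (- 1) powi (int d * (a + 1)) * (rat_of_int (int d * a - 1) gchoose (d - 1))"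
  unfolding powi_eq_parity_sign of_int_zchoose[symmetric] by (simp add: bps_num_def distrib_left)

text \<open>
  The formulas for the extremal invariants differ only in the framing \<open>a\<close> of the binomial
  coefficient and in the exponent \<open>e\<close> of the sign; in each of them \<open>e\<close> and
  \<open>a + 1\<close> have the same parity, which turns the sum into the case \<open>k = 0\<close>, where every
  divisor of \<open>r\<close> is a common divisor.
\<close>

lemma extremal_sum_in_Ints:
  assumes "r \<ge> 1" and even: "even (e - (a + 1))"
  shows "1 / (rat_of_nat r)\<^sup>2 *
     (\<Sum>d | d dvd r. rat_of_int (moebius (r div d)) * (-1) powi (int d * e)
        * (rat_of_int (int d * a - 1) gchoose (d - 1))) \<in> \<int>" (is "?q * ?S \<in> _")
proof -
  have "?S = (\<Sum>d | d dvd r. rat_of_int (moebius (r div d) * bps_num a d 0))"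
  proof (intro sum.cong refl)
    fix d
    have "parity_sign (int d * e) = parity_sign (int d * (a + 1))" using even by (auto simp: parity_sign_def)
    then show "rat_of_int (moebius (r div d)) * (-1) powi (int d * e)
        * (rat_of_int (int d * a - 1) gchoose (d - 1)) = rat_of_int (moebius (r div d) * bps_num a d 0)"
      by (simp only: of_int_mult of_int_bps_num_0 powi_eq_parity_sign mult.assoc)
  qed
  also have "\<dots> = (\<Sum>d | d dvd r. rat_of_int (moebius d * bps_num a (r div d) 0))"
    by (rule sum.reindex_bij_witness[of _ "\<lambda>d. r div d" "\<lambda>d. r div d"])
      (use assms(1) in \<open>auto elim!: dvdE\<close>)
  finally have S: "?S = rat_of_int (\<Sum>d | d dvd r. moebius d * bps_num a (r div d) 0)" by simp
  obtain z where "(\<Sum>d | d dvd r. moebius d * bps_num a (r div d) 0) = (int r)\<^sup>2 * z"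
    using square_dvd_moebius_sum[of r 0 a] assms(1) by (auto elim: dvdE)
  then have "?q * ?S = rat_of_int z" using assms(1) unfolding S by simp
  then show ?thesis by simp
qed

lemma unknot_c_eq_bps_num:
  assumes "int K \<le> int R"
  shows "unknot_c t R (2 * int K - int R) = rat_of_int (bps_num t R K)"
  using assms by (simp add: unknot_c_def bps_num_def powi_eq_parity_sign of_int_zchoose)

text \<open>
  If \<open>m\<close> has the wrong parity or size, then so has every \<open>m/d\<close> relative to
  \<open>r/d\<close>, and every term vanishes. Otherwise \<open>m = 2 k - r\<close> with
  \<open>0 \<le> k \<le> r\<close>. The definition sums over the common divisors of \<open>r\<close> and
  \<open>m\<close>; one that does not divide \<open>k\<close> makes \<open>(r + m)/d\<close> odd and contributes 0.
\<close>

lemma unknot_bps_in_Ints: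
  assumes "r \<ge> 1"
  shows "unknot_bps t r m \<in> \<int>"
proof (cases "even (int r + m) \<and> \<bar>m\<bar> \<le> int r")
  case False
  have "unknot_c t (r div d) (m div int d) = 0" if d: "d dvd r" "int d dvd m" for d
  proof -
    obtain R M where RM: "r = d * R" "m = int d * M" using d by (auto elim!: dvdE)
    have "d > 0" using RM assms by (auto intro!: Nat.gr0I)
    then have quot: "r div d = R" "m div int d = M" using RM by auto
    have "int r + m = int d * (int R + M)" using RM by (simp add: distrib_left)
    moreover have "\<bar>m\<bar> \<le> int r" if "\<bar>M\<bar> \<le> int R"
      using that RM mult_left_mono[OF that, of "int d"] by (simp add: abs_mult)
    ultimately have "\<not> (even (int R + M) \<and> \<bar>M\<bar> \<le> int R)" using False by auto
    then show ?thesis unfolding quot unknot_c_def by (rule if_not_P)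
  qed
  then have "(\<Sum>d | d dvd r \<and> int d dvd m. rat_of_int (moebius d) * unknot_c t (r div d) (m div int d)) = 0"
    by (intro sum.neutral) auto
  then show ?thesis by (simp only: unknot_bps_def) simp
next
  case True
  then obtain k' where k': "int r + m = 2 * k'" by (blast elim: evenE)
  define k where "k = nat k'"
  have k: "int k = k'" "m = 2 * int k - int r" "k \<le> r" using k' True by (auto simp: k_def)
  have sub: "{d. d dvd gcd r k} \<subseteq> {d. d dvd r \<and> int d dvd m}" using k by auto
  have "(\<Sum>d | d dvd r \<and> int d dvd m. rat_of_int (moebius d) * unknot_c t (r div d) (m div int d))
      = (\<Sum>d | d dvd gcd r k. rat_of_int (moebius d) * unknot_c t (r div d) (m div int d))"
  proof (rule sum.mono_neutral_right[OF _ sub])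
    show "finite {d. d dvd r \<and> int d dvd m}"
      using assms by (intro finite_subset[OF _ finite_divisors_nat[of r]]) auto
    show "\<forall>d\<in>{d. d dvd r \<and> int d dvd m} - {d. d dvd gcd r k}.
        rat_of_int (moebius d) * unknot_c t (r div d) (m div int d) = 0"
    proof
      fix d assume d: "d \<in> {d. d dvd r \<and> int d dvd m} - {d. d dvd gcd r k}"
      then obtain R M where RM: "r = d * R" "m = int d * M" by (auto elim!: dvdE)
      have d0: "d > 0" using RM assms by (auto intro!: Nat.gr0I)
      then have quot: "r div d = R" "m div int d = M" using RM by auto
      have "odd (int R + M)"
      proof
        assume "even (int R + M)"
        then obtain u where "int R + M = 2 * u" by (blast elim: evenE)
        moreover have "2 * int k = int d * (int R + M)" using k RM by (simp add: distrib_left)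
        ultimately have "int k = int d * u" by simp
        then have "int d dvd int k" by simp
        then have "d dvd k" by simp
        with d show False by auto
      qed
      then show "rat_of_int (moebius d) * unknot_c t (r div d) (m div int d) = 0"
        unfolding quot unknot_c_def by simp
    qed
  qed
  also have "\<dots> = (\<Sum>d | d dvd gcd r k. rat_of_int (moebius d * bps_num t (r div d) (k div d)))"
  proof (intro sum.cong refl)
    fix d assume "d \<in> {d. d dvd gcd r k}"
    then obtain R K where RK: "r = d * R" "k = d * K" by (auto elim!: dvdE)
    have d: "d > 0" using RK assms by (auto intro!: Nat.gr0I)
    have "m = int d * (2 * int K - int R)" using k RK by (simp add: algebra_simps)
    then have "r div d = R" "k div d = K" "m div int d = 2 * int K - int R" using RK d by auto
    moreover have "K \<le> R" using k(3) RK d by simp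
    ultimately show "rat_of_int (moebius d) * unknot_c t (r div d) (m div int d)
        = rat_of_int (moebius d * bps_num t (r div d) (k div d))"
      by (simp add: unknot_c_eq_bps_num)
  qed
  finally have S: "unknot_bps t r m = 1 / (rat_of_nat r)\<^sup>2
      * rat_of_int (\<Sum>d | d dvd gcd r k. moebius d * bps_num t (r div d) (k div d))"
    by (simp add: unknot_bps_def)
  obtain z where "(\<Sum>d | d dvd gcd r k. moebius d * bps_num t (r div d) (k div d)) = (int r)\<^sup>2 * z"
    using square_dvd_moebius_sum[OF assms k(3), of t] by (auto elim: dvdE)
  then have "unknot_bps t r m = rat_of_int z" using assms unfolding S by simp
  then show ?thesis by simp
qed

theorem theorem1p4:
  fixes r :: nat and m t p :: int
  assumes "r \<ge> 1" and "p \<le> -1 \<or> p \<ge> 2"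
  shows "unknot_bps t r m \<in> \<int> \<and>
         unknot_bps_plus t r \<in> \<int> \<and>
         unknot_bps_minus t r \<in> \<int> \<and>
         twist_bps_plus p t r \<in> \<int> \<and>
         twist_bps_minus p t r \<in> \<int>"
proof (intro conjI)
  note ext = extremal_sum_in_Ints[OF assms(1)]
  show "unknot_bps t r m \<in> \<int>" using unknot_bps_in_Ints[OF assms(1)] .
  show "unknot_bps_plus t r \<in> \<int>"
    unfolding unknot_bps_plus_def by (rule ext) simp
  show "unknot_bps_minus t r \<in> \<int>"
    unfolding unknot_bps_minus_def by (rule ext) simp
  show "twist_bps_plus p t r \<in> \<int>"
  proof (cases "p \<le> -1")
    case True
    then show ?thesis unfolding twist_bps_plus_def if_P[OF True] by (intro ext) simp
  next
    case False
    with assms(2) have "p \<ge> 2" by simp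
    then show ?thesis unfolding twist_bps_plus_def if_not_P[OF False] if_P[OF \<open>p \<ge> 2\<close>] by (intro ext) simp
  qed
  show "twist_bps_minus p t r \<in> \<int>"
  proof (cases "p \<le> -1")
    case True
    show ?thesis
      unfolding twist_bps_minus_def if_P[OF True] mult_minus_left by (intro Ints_minus ext) simp
  next
    case False
    with assms(2) have "p \<ge> 2" by simp
    then show ?thesis unfolding twist_bps_minus_def if_not_P[OF False] if_P[OF \<open>p \<ge> 2\<close>] by (intro ext) simp
  qed
qed

end
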